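(* Let $g:\mathbb{R}^n\to\mathbb{R}$ be continuously differentiable with $\|\nabla g(u)-\nabla g(v)\|\le L\|u-v\|$ for all $u,v\in\mathbb{R}^n$ for some constant $L>0$; let $h_1:\mathbb{R}^n\to\mathbb{R}\cup\{\infty\}$ be proper, lower semicontinuous and convex; let $h_2:\mathbb{R}^n\to\mathbb{R}$ be continuous and convex; and let $f=g+h_1-h_2$. Let $\{x_k\}_{k\ge 0}$, $\{d_k\}_{k\ge0}$ be generated by the inexact proximal DC Newton-type method described in the context, and suppose there are constants $m,M>0$ such that the matrices $B_k$ satisfy $m\|u\|^2\le u^TB_ku\le M\|u\|^2$ for all $u\in\mathbb{R}^n$ and all $k$. Assume $d_k\neq 0$ for all $k$. If $f$ is bounded below, then $$\lim_{k\to\infty}\|d_k\|=0.$$ Furthermore, if in addition $\{x_k\}$ is bounded, then every accumulation point $x^\ast$ of $\{x_k\}$ is a critical point, i.e. $0\in\nabla g(x^\ast)+\partial h_1(x^\ast)-\partial h_2(x^\ast)$.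
   Context: Notation: $\|\cdot\|$ is the Euclidean norm, $\|x\|_A=\sqrt{x^TAx}$ for a symmetric positive definite matrix $A$, $\partial$ is the convex subdifferential, and the difference of sets is the Minkowski difference $\{a-b\}$. Inexact proximal DC Newton-type method. Parameters: $x_0\in\mathrm{dom}(f)=\{x: f(x)<\infty\}$, $\delta\in(0,1)$, $\bar\theta\in(0,1]$, $0<\beta_{min}\le\beta_{max}<1$. For $k=0,1,2,\dots$: choose a symmetric positive definite matrix $B_k\in\mathbb{R}^{n\times n}$ and put $H_k=B_k^{-1}$; choose $\xi_k\in\partial h_2(x_k)$ and $\theta_k\in[\bar\theta,1]$; compute $x_k^+$ and $r_k\in\mathbb{R}^n$ satisfying $$r_k\in\nabla g(x_k)-\xi_k+B_k(x_k^+-x_k)+\partial h_1(x_k^+),\qquad \|r_k\|_{H_k}\le(1-\theta_k)\|x_k^+-x_k\|_{B_k};$$ put $d_k=x_k^+-x_k$. Backtracking: start with $\rho=1$; while the condition $$f(x_k+\rho d_k)\le f(x_k)+\delta\rho\big((\nabla g(x_k)-\xi_k)^Td_k+h_1(x_k^+)-h_1(x_k)\big)$$ fails, choose some $\beta\in[\beta_{min},\beta_{max}]$ and replace $\rho$ by $\beta\rho$. Let $\eta_k$ be the final $\rho$ and set $x_{k+1}=x_k+\eta_kd_k$. *)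

theory Defs
  imports "HOL-Analysis.Analysis" "HOL-Library.Set_Algebras"
begin

definition eff_domain :: "('a \<Rightarrow> ereal) \<Rightarrow> 'a set"
  where "eff_domain h = {x. h x < \<infinity>}"

definition proper_fun :: "('a \<Rightarrow> ereal) \<Rightarrow> bool"
  where "proper_fun h \<longleftrightarrow> (\<forall>x. h x \<noteq> -\<infinity>) \<and> eff_domain h \<noteq> {}"

definition lsc_fun :: "('a::topological_space \<Rightarrow> ereal) \<Rightarrow> bool"
  where "lsc_fun h \<longleftrightarrow> (\<forall>x. h x \<le> Liminf (at x) h)"

text \<open>
  The analogue of \<^const>\<open>convex_on\<close> for extended-valued functions on the whole space. It is
  only meant for functions that avoid the value \<open>-\<infinity>\<close>; then the sum on the right-hand side
  is never of the form \<open>\<infinity> - \<infinity>\<close>.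
\<close>

definition convex_fun :: "('a::real_vector \<Rightarrow> ereal) \<Rightarrow> bool"
  where "convex_fun h \<longleftrightarrow> (\<forall>x y. \<forall>u\<ge>0. \<forall>v\<ge>0. u + v = 1 \<longrightarrow>
    h (u *\<^sub>R x + v *\<^sub>R y) \<le> ereal u * h x + ereal v * h y)"

text \<open>The subdifferential is empty at points where \<open>h\<close> is not finite.\<close>

definition subdifferential :: "('a::real_inner \<Rightarrow> ereal) \<Rightarrow> 'a \<Rightarrow> 'a set"
  where "subdifferential h x =
    {v. \<bar>h x\<bar> \<noteq> \<infinity> \<and> (\<forall>y. h x + ereal (v \<bullet> (y - x)) \<le> h y)}"

text \<open>The operator \<open>-\<close> on sets is the set-theoretic difference.\<close>

definition minkowski_diff :: "'a::minus set \<Rightarrow> 'a set \<Rightarrow> 'a set"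
  where "minkowski_diff S T = {a - b | a b. a \<in> S \<and> b \<in> T}"

definition critical_point ::
    "('a::real_inner \<Rightarrow> 'a) \<Rightarrow> ('a \<Rightarrow> ereal) \<Rightarrow> ('a \<Rightarrow> real) \<Rightarrow> 'a \<Rightarrow> bool"
  where "critical_point grad_g h1 h2 x \<longleftrightarrow>
    0 \<in> minkowski_diff (grad_g x +o subdifferential h1 x)
          (subdifferential (\<lambda>y. ereal (h2 y)) x)"

definition sym_pos_def :: "real^'n^'n \<Rightarrow> bool"
  where "sym_pos_def A \<longleftrightarrow> transpose A = A \<and> (\<forall>u. u \<noteq> 0 \<longrightarrow> 0 < u \<bullet> (A *v u))"

definition weighted_norm :: "real^'n^'n \<Rightarrow> real^'n \<Rightarrow> real"
  where "weighted_norm A u = sqrt (u \<bullet> (A *v u))"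

text \<open>
  The values taken by \<open>\<rho>\<close> in a backtracking loop with acceptance test \<open>ok\<close>; every
  reduction may use a different factor.
\<close>

inductive backtracking_trial :: "real \<Rightarrow> real \<Rightarrow> (real \<Rightarrow> bool) \<Rightarrow> real \<Rightarrow> bool"
  for \<beta>min \<beta>max :: real and ok :: "real \<Rightarrow> bool" where
  start: "backtracking_trial \<beta>min \<beta>max ok 1"
| shrink: "\<lbrakk>backtracking_trial \<beta>min \<beta>max ok \<rho>; \<not> ok \<rho>; \<beta>min \<le> \<beta>; \<beta> \<le> \<beta>max\<rbrakk>
    \<Longrightarrow> backtracking_trial \<beta>min \<beta>max ok (\<beta> * \<rho>)"

definition backtracking_result :: "real \<Rightarrow> real \<Rightarrow> (real \<Rightarrow> bool) \<Rightarrow> real \<Rightarrow> bool"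
  where "backtracking_result \<beta>min \<beta>max ok \<eta> \<longleftrightarrow> backtracking_trial \<beta>min \<beta>max ok \<eta> \<and> ok \<eta>"

end

theory Submission
  imports Defs
begin

text \<open>
  Convexity of \<open>h1\<close> and the bound on the residual show that the model decrease
  \<open>\<Delta> = (\<nabla>g(x) - \<xi>) \<bullet> d + h1(x\<^sup>+) - h1(x)\<close> is at most \<open>-\<theta> \<parallel>d\<parallel>\<^sub>B\<^sup>2\<close>. Since \<open>f(x + \<rho>d)\<close> is at most
  \<open>f(x) + \<rho>\<Delta> + L\<rho>\<^sup>2\<parallel>d\<parallel>\<^sup>2\<close>, every small enough step is accepted, so the step sizes are bounded
  away from \<open>0\<close> and each iteration decreases \<open>f\<close> by at least a fixed multiple of \<open>\<parallel>d\<parallel>\<^sup>2\<close>.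
  Hence \<open>\<parallel>d\<parallel>\<^sup>2\<close> is summable. Along a convergent subsequence the subgradients of \<open>h2\<close> are bounded,
  and criticality follows in the limit from the closedness of the subdifferential graphs.
\<close>

section \<open>Norms weighted by a positive definite matrix\<close>

lemma inner_matrix_symmetric:
  fixes A :: "real^'n^'n"
  assumes "transpose A = A"
  shows "u \<bullet> (A *v v) = v \<bullet> (A *v u)"
  by (metis assms dot_lmul_matrix inner_commute vector_transpose_matrix)

lemma sym_pos_def_nonneg:
  assumes "sym_pos_def A"
  shows "0 \<le> u \<bullet> (A *v u)"
  using assms by (cases "u = 0") (auto simp: sym_pos_def_def less_imp_le)

text \<open>The quadratic form is nonnegative at \<open>u - t *\<^sub>R v\<close>; the choice
  \<open>t = p / q\<close> minimises it over \<open>t\<close>, and the minimum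
  \<open>u \<bullet> (A *v u) - p\<^sup>2 / q\<close> gives the bound.\<close>

lemma weighted_norm_Cauchy_Schwarz:
  assumes A: "sym_pos_def A"
  shows "u \<bullet> (A *v v) \<le> weighted_norm A u * weighted_norm A v"
proof (cases "v = 0")
  case True
  then show ?thesis by (simp add: weighted_norm_def)
next
  case False
  define q where "q = v \<bullet> (A *v v)"
  define p where "p = u \<bullet> (A *v v)"
  define t where "t = p / q"
  have q: "q > 0" using A False by (simp add: sym_pos_def_def q_def)
  have sym: "v \<bullet> (A *v u) = p"
    using A inner_matrix_symmetric unfolding sym_pos_def_def p_def by metis
  have "0 \<le> (u - t *\<^sub>R v) \<bullet> (A *v (u - t *\<^sub>R v))"
    by (rule sym_pos_def_nonneg[OF A])
  also have "\<dots> = u \<bullet> (A *v u) - 2 * t * p + t * t * q"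
    using sym by (simp add: matrix_vector_mult_diff_distrib matrix_vector_mult_scaleR inner_diff
        algebra_simps p_def[symmetric] q_def[symmetric])
  also have "\<dots> = u \<bullet> (A *v u) - p\<^sup>2 / q"
    using q by (simp add: t_def power2_eq_square field_simps)
  finally have "p\<^sup>2 \<le> (u \<bullet> (A *v u)) * q"
    using q by (simp add: field_simps)
  then have "p \<le> sqrt ((u \<bullet> (A *v u)) * q)"
    by (rule real_le_rsqrt)
  then show ?thesis
    by (simp add: weighted_norm_def real_sqrt_mult p_def q_def)
qed

lemma sym_pos_def_matrix_inv_right:
  fixes A :: "real^'n^'n"
  assumes "sym_pos_def A"
  shows "A ** matrix_inv A = mat 1"
proof -
  have "u = 0" if "A *v u = 0" for u
    using assms that unfolding sym_pos_def_def by force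
  then have "invertible A"
    using invertible_left_inverse matrix_left_invertible_ker by blast
  then show ?thesis
    unfolding invertible_def matrix_inv_def by (rule someI2_ex) simp
qed

text \<open>Writing \<open>r = A *v w\<close> turns the dual norm of \<open>r\<close> into the
  \<open>A\<close>-norm of \<open>w\<close>, so Cauchy-Schwarz for \<open>A\<close> suffices and
  positivity of the inverse need not be proved.\<close>

lemma inner_le_dual_weighted_norm:
  assumes A: "sym_pos_def A"
  shows "r \<bullet> u \<le> weighted_norm (matrix_inv A) r * weighted_norm A u"
proof -
  define w where "w = matrix_inv A *v r"
  have r: "A *v w = r"
    by (simp add: w_def matrix_vector_mul_assoc sym_pos_def_matrix_inv_right[OF A])
  have "weighted_norm (matrix_inv A) r = weighted_norm A w"
    by (simp add: weighted_norm_def w_def[symmetric] r inner_commute)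
  moreover have "r \<bullet> u = w \<bullet> (A *v u)"
    using A inner_matrix_symmetric r inner_commute unfolding sym_pos_def_def by metis
  ultimately show ?thesis
    using weighted_norm_Cauchy_Schwarz[OF A] by simp
qed

lemma weighted_norm_nonneg:
  assumes "sym_pos_def A"
  shows "0 \<le> weighted_norm A u"
  using sym_pos_def_nonneg[OF assms] by (simp add: weighted_norm_def)

lemma weighted_norm_le:
  assumes "u \<bullet> (A *v u) \<le> M * (norm u)\<^sup>2"
  shows "weighted_norm A u \<le> sqrt M * norm u"
proof -
  have "weighted_norm A u \<le> sqrt (M * (norm u)\<^sup>2)"
    using assms by (simp add: weighted_norm_def)
  then show ?thesis by (simp add: real_sqrt_mult)
qed

text \<open>Cauchy-Schwarz with the test vector \<open>w = A *v u\<close> turns the bound on the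
  quadratic form into one on the operator, without eigenvalues. Each weighted norm contributes a
  factor \<open>sqrt M\<close>.\<close>

lemma norm_matrix_vector_le:
  assumes A: "sym_pos_def A" and M: "M > 0" "\<And>u. u \<bullet> (A *v u) \<le> M * (norm u)\<^sup>2"
  shows "norm (A *v u) \<le> M * norm u"
proof -
  define w where "w = A *v u"
  have "norm w * norm w = w \<bullet> (A *v u)"
    by (simp add: w_def power2_norm_eq_inner flip: power2_eq_square)
  also have "\<dots> \<le> weighted_norm A w * weighted_norm A u"
    by (rule weighted_norm_Cauchy_Schwarz[OF A])
  also have "\<dots> \<le> (sqrt M * norm w) * (sqrt M * norm u)"
    by (intro mult_mono weighted_norm_le M weighted_norm_nonneg A) (use M in auto)
  also have "\<dots> = norm w * (M * norm u)"
    using M by (simp add: algebra_simps)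
  finally show ?thesis
    using M by (cases "norm w = 0") (auto simp: w_def mult_le_cancel_left)
qed

text \<open>Pairing \<open>r\<close> with itself in the dual inequality converts the inexactness
  criterion into a Euclidean bound.\<close>

lemma norm_residual_le:
  assumes A: "sym_pos_def A" and M: "M > 0" "\<And>u. u \<bullet> (A *v u) \<le> M * (norm u)\<^sup>2"
    and r: "weighted_norm (matrix_inv A) r \<le> weighted_norm A u"
  shows "norm r \<le> M * norm u"
proof -
  have "norm r * norm r = r \<bullet> r"
    by (simp add: power2_norm_eq_inner flip: power2_eq_square)
  also have "\<dots> \<le> weighted_norm (matrix_inv A) r * weighted_norm A r"
    by (rule inner_le_dual_weighted_norm[OF A])
  also have "\<dots> \<le> weighted_norm A u * weighted_norm A r"
    by (intro mult_right_mono r weighted_norm_nonneg A)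
  also have "\<dots> \<le> (sqrt M * norm u) * (sqrt M * norm r)"
    by (intro mult_mono weighted_norm_le M weighted_norm_nonneg A) (use M in auto)
  also have "\<dots> = norm r * (M * norm u)"
    using M by (simp add: algebra_simps)
  finally show ?thesis
    using M by (cases "norm r = 0") (auto simp: mult_le_cancel_left)
qed

section \<open>Descent estimates and backtracking\<close>

lemma lipschitz_gradient_upper_bound:
  fixes g :: "'a::real_inner \<Rightarrow> real"
  assumes g: "\<And>u. GDERIV g u :> G u"
    and lip: "\<And>u v. norm (G u - G v) \<le> L * norm (u - v)" and "L > 0" "\<rho> > 0"
  shows "g (a + \<rho> *\<^sub>R e) \<le> g a + \<rho> * (G a \<bullet> e) + L * \<rho>\<^sup>2 * (norm e)\<^sup>2"
proof -
  have "((\<lambda>t. g (a + t *\<^sub>R e)) has_real_derivative (e \<bullet> G (a + t *\<^sub>R e))) (at t)" for t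
  proof -
    have "((\<lambda>t. a + t *\<^sub>R e) has_derivative (\<lambda>s. s *\<^sub>R e)) (at t)"
      by (auto intro!: derivative_eq_intros)
    from has_derivative_compose[OF this g[unfolded gderiv_def]] show ?thesis
      by (simp add: has_field_derivative_def mult_commute_abs)
  qed
  \<comment> \<open>The mean value theorem replaces the usual integral along the segment. Since
    \<open>t\<close> is only known to lie below \<open>\<rho>\<close>, the constant is
    \<open>L\<close> instead of \<open>L / 2\<close>.\<close>
  then obtain t where t: "0 < t" "t < \<rho>"
    and eq: "g (a + \<rho> *\<^sub>R e) - g (a + 0 *\<^sub>R e) = (\<rho> - 0) * (e \<bullet> G (a + t *\<^sub>R e))"
    using MVT2[of 0 \<rho> "\<lambda>t. g (a + t *\<^sub>R e)" "\<lambda>t. e \<bullet> G (a + t *\<^sub>R e)"] \<open>\<rho> > 0\<close> by blast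
  have "e \<bullet> (G (a + t *\<^sub>R e) - G a) \<le> norm e * norm (G (a + t *\<^sub>R e) - G a)"
    by (rule norm_cauchy_schwarz)
  also have "\<dots> \<le> norm e * (L * (t * norm e))"
    using lip[of "a + t *\<^sub>R e" a] t by (intro mult_left_mono) auto
  also have "\<dots> \<le> norm e * (L * (\<rho> * norm e))"
    using t \<open>L > 0\<close> by (intro mult_left_mono mult_right_mono) auto
  finally have "\<rho> * (e \<bullet> (G (a + t *\<^sub>R e) - G a)) \<le> \<rho> * (norm e * (L * (\<rho> * norm e)))"
    using \<open>\<rho> > 0\<close> by (intro mult_left_mono) auto
  with eq show ?thesis
    by (simp add: algebra_simps inner_commute power2_eq_square)
qed

text \<open>A rejected trial exceeds \<open>\<rho>0\<close>, so one more reduction, by a factor at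
  least \<open>\<beta>min\<close>, stays above \<open>\<beta>min * \<rho>0\<close>; the value
  \<open>1\<close> covers the loop that never shrinks. The bounds \<open>0 < \<rho> \<le> 1\<close>
  are carried along because \<open>ok\<close> is only available there.\<close>

lemma backtracking_trial_lower_bound:
  assumes "backtracking_trial \<beta>min \<beta>max ok \<rho>"
    and \<beta>: "0 < \<beta>min" "\<beta>max < 1"
    and ok: "\<And>\<rho>. 0 < \<rho> \<Longrightarrow> \<rho> \<le> 1 \<Longrightarrow> \<rho> \<le> \<rho>0 \<Longrightarrow> ok \<rho>"
  shows "0 < \<rho> \<and> \<rho> \<le> 1 \<and> min 1 (\<beta>min * \<rho>0) \<le> \<rho>"
  using assms(1)
proof induction
  case start
  then show ?case by simp
next
  case (shrink \<rho> b)
  then have "\<rho>0 < \<rho>" using ok by force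
  then have "\<beta>min * \<rho>0 \<le> b * \<rho>"
    using shrink \<beta> by (meson less_imp_le mult_left_mono mult_mono order_trans mult_right_mono)
  moreover have "0 < b * \<rho>" using shrink \<beta> by auto
  moreover have "b * \<rho> \<le> 1" using shrink \<beta> by (intro mult_le_one) auto
  ultimately show ?case by auto
qed

text \<open>\<open>F\<close> decreases and is bounded below, hence converges; its consecutive
  differences tend to zero and dominate \<open>C * (a k)\<^sup>2\<close>.\<close>

lemma tendsto_zero_if_square_decrease:
  fixes F a :: "nat \<Rightarrow> real"
  assumes "\<And>k. F (Suc k) \<le> F k - C * (a k)\<^sup>2" "C > 0" "\<And>k. c \<le> F k"
  shows "a \<longlonglongrightarrow> 0"
proof -
  have "decseq F"
    using assms(1,2) by (intro decseq_SucI) (smt (verit) zero_le_power2 mult_nonneg_nonneg)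
  then obtain l where l: "F \<longlonglongrightarrow> l"
    using decseq_convergent assms(3) by blast
  have "(\<lambda>k. (F k - F (Suc k)) / C) \<longlonglongrightarrow> (l - l) / C"
    by (intro tendsto_intros l LIMSEQ_Suc) (use assms in auto)
  then have lim: "(\<lambda>k. (F k - F (Suc k)) / C) \<longlonglongrightarrow> 0" by simp
  have "\<forall>k. norm ((a k)\<^sup>2) \<le> (F k - F (Suc k)) / C"
    using assms(1,2) by (simp add: field_simps)
  then have "(\<lambda>k. (a k)\<^sup>2) \<longlonglongrightarrow> 0"
    by (rule Lim_null_comparison[OF always_eventually lim])
  then have "(\<lambda>k. sqrt ((a k)\<^sup>2)) \<longlonglongrightarrow> sqrt 0"
    by (rule tendsto_real_sqrt)
  then show ?thesis
    by (simp add: tendsto_rabs_zero_iff)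
qed

section \<open>Lower semicontinuity and limits of subgradients\<close>

lemma lsc_fun_eventually_less:
  assumes "lsc_fun h" "(u \<longlongrightarrow> a) F" "c < h a"
  shows "eventually (\<lambda>k. c < h (u k)) F"
proof -
  have "c < Liminf (at a) h"
    using assms(1,3) unfolding lsc_fun_def by (meson less_le_trans)
  then have "eventually (\<lambda>z. c < h z) (at a)"
    by (rule less_LiminfD)
  \<comment> \<open>\<open>Liminf (at a)\<close> ignores the point \<open>a\<close> itself;
    \<open>c < h a\<close> fills it in, so \<open>u\<close> may take the value
    \<open>a\<close>.\<close>
  then have "eventually (\<lambda>z. c < h z) (nhds a)"
    using assms(3) by (simp add: eventually_nhds_conv_at)
  then show ?thesis
    using assms(2) by (rule eventually_compose_filterlim)
qed

lemma subdifferential_closed_graph: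
  fixes h :: "'a::real_inner \<Rightarrow> ereal"
  assumes h: "proper_fun h" "lsc_fun h"
    and v: "\<And>k. v k \<in> subdifferential h (u k)"
    and lim: "u \<longlonglongrightarrow> a" "v \<longlonglongrightarrow> b"
  shows "b \<in> subdifferential h a"
proof -
  \<comment> \<open>The limiting subgradient inequality with \<open>h a\<close> isolated: this form
    makes sense before \<open>h a\<close> is known to be finite. If it failed, a real
    \<open>e\<close> strictly between the two sides would eventually lie below
    \<open>h (u k)\<close>, hence below the limit of the upper bounds.\<close>
  have le: "h a \<le> ereal (c - b \<bullet> (y - a))" if y: "h y = ereal c" for y c
  proof (rule ccontr)
    assume "\<not> ?thesis"
    then obtain e where e: "ereal (c - b \<bullet> (y - a)) < ereal e" "ereal e < h a"
      by (metis ereal_dense2 not_le)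
    have upper: "h (u k) \<le> ereal (c - v k \<bullet> (y - u k))" for k
    proof -
      have "\<bar>h (u k)\<bar> \<noteq> \<infinity>" "h (u k) + ereal (v k \<bullet> (y - u k)) \<le> ereal c"
        using v[of k] unfolding subdifferential_def y[symmetric] by auto
      then show ?thesis by (cases "h (u k)") auto
    qed
    have "eventually (\<lambda>k. ereal e < h (u k)) sequentially"
      by (rule lsc_fun_eventually_less[OF h(2) lim(1) e(2)])
    then have "eventually (\<lambda>k. e \<le> c - v k \<bullet> (y - u k)) sequentially"
    proof (rule eventually_mono)
      fix k
      assume "ereal e < h (u k)"
      also note upper[of k]
      finally show "e \<le> c - v k \<bullet> (y - u k)" by simp
    qed
    moreover have "(\<lambda>k. c - v k \<bullet> (y - u k)) \<longlonglongrightarrow> c - b \<bullet> (y - a)"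
      by (intro tendsto_intros lim)
    ultimately have "e \<le> c - b \<bullet> (y - a)"
      using tendsto_lowerbound by (metis sequentially_bot)
    with e show False by simp
  qed
  \<comment> \<open>Applying \<open>le\<close> at one point of the effective domain excludes
    \<open>h a = \<infinity>\<close>.\<close>
  obtain y0 where "h y0 < \<infinity>" "h y0 \<noteq> -\<infinity>"
    using h(1) unfolding proper_fun_def eff_domain_def by auto
  then obtain c0 where "h y0 = ereal c0" by (cases "h y0") auto
  from le[OF this] have "h a \<noteq> \<infinity>" by auto
  moreover have "h a \<noteq> -\<infinity>" using h(1) by (simp add: proper_fun_def)
  ultimately obtain \<alpha> where \<alpha>: "h a = ereal \<alpha>" by (cases "h a") auto
  have "h a + ereal (b \<bullet> (y - a)) \<le> h y" for y
    using le[of y] h(1) \<alpha> by (cases "h y") (auto simp: proper_fun_def algebra_simps)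
  then show ?thesis by (simp add: subdifferential_def \<alpha>)
qed

lemma subdifferential_realD:
  "v \<in> subdifferential (\<lambda>u. ereal (h u)) a \<Longrightarrow> h a + v \<bullet> (y - a) \<le> h y"
  by (auto simp: subdifferential_def)

lemma lsc_fun_ereal_continuous:
  assumes "continuous_on UNIV h"
  shows "lsc_fun (\<lambda>u. ereal (h u))"
  unfolding lsc_fun_def
proof
  fix a
  show "ereal (h a) \<le> Liminf (at a) (\<lambda>u. ereal (h u))"
  proof (cases "at a = bot")
    case True
    then show ?thesis by simp
  next
    case False
    have "((\<lambda>u. ereal (h u)) \<longlongrightarrow> ereal (h a)) (at a)"
      using assms by (simp add: continuous_on_def)
    from lim_imp_Liminf[OF False this] show ?thesis by simp
  qed
qed

text \<open>The subgradient inequality is tested one unit away in the direction of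
  \<open>v k\<close>: the norm of \<open>v k\<close> is then at most a difference of two values of
  \<open>h\<close> on a compact ball.\<close>

lemma subgradients_bounded:
  fixes h :: "'a::euclidean_space \<Rightarrow> real"
  assumes cont: "continuous_on UNIV h" and u: "bounded (range u)"
    and v: "\<And>k. v k \<in> subdifferential (\<lambda>u. ereal (h u)) (u k)"
  shows "bounded (range v)"
proof -
  obtain R where R: "\<And>k. norm (u k) \<le> R"
    using u by (auto simp: bounded_iff)
  have "bounded (h ` cball 0 (R + 1))"
    by (intro compact_imp_bounded compact_continuous_image continuous_on_subset[OF cont]) auto
  then obtain K where "\<forall>z\<in>cball 0 (R + 1). \<bar>h z\<bar> \<le> K"
    by (auto simp: bounded_iff)
  then have K: "\<bar>h z\<bar> \<le> K" if "norm z \<le> R + 1" for z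
    using that by simp
  have "norm (v k) \<le> 2 * K" for k
  proof -
    \<comment> \<open>\<open>sgn 0 = 0\<close>, so this test point also covers a vanishing
      subgradient.\<close>
    have "norm (u k + sgn (v k)) \<le> R + 1"
      using norm_triangle_ineq[of "u k" "sgn (v k)"] R[of k] by (auto simp: norm_sgn split: if_splits)
    then have "\<bar>h (u k + sgn (v k))\<bar> \<le> K" by (rule K)
    moreover have "\<bar>h (u k)\<bar> \<le> K" using R[of k] by (intro K) auto
    moreover have "v k \<bullet> sgn (v k) = norm (v k)"
      by (cases "v k = 0") (simp_all add: sgn_div_norm power2_norm_eq_inner[symmetric] power2_eq_square)
    ultimately show ?thesis
      using subdifferential_realD[OF v, of k "u k + sgn (v k)"] by simp
  qed
  then show ?thesis by (auto simp: bounded_iff)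
qed

theorem theorem2:
  fixes g h2 :: "real^'n \<Rightarrow> real"
    and grad_g :: "real^'n \<Rightarrow> real^'n"
    and h1 f :: "real^'n \<Rightarrow> ereal"
    and L \<delta> \<theta>bar \<beta>min \<beta>max m M :: real
    and x xp d r \<xi> :: "nat \<Rightarrow> real^'n"
    and B H :: "nat \<Rightarrow> real^'n^'n"
    and \<theta> \<eta> :: "nat \<Rightarrow> real"
  assumes g_grad: "\<And>u. GDERIV g u :> grad_g u"
    and grad_cont: "continuous_on UNIV grad_g"
    and L_pos: "L > 0"
    and grad_lipschitz: "\<And>u v. norm (grad_g u - grad_g v) \<le> L * norm (u - v)"
    and h1_proper: "proper_fun h1"
    and h1_lsc: "lsc_fun h1"
    and h1_convex: "convex_fun h1"
    and h2_cont: "continuous_on UNIV h2"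
    and h2_convex: "convex_on UNIV h2"
    and f_eq: "\<And>u. f u = ereal (g u) + h1 u - ereal (h2 u)"
    and x0: "x 0 \<in> eff_domain f"
    and \<delta>: "0 < \<delta>" "\<delta> < 1"
    and \<theta>bar: "0 < \<theta>bar" "\<theta>bar \<le> 1"
    and \<beta>: "0 < \<beta>min" "\<beta>min \<le> \<beta>max" "\<beta>max < 1"
    and B_spd: "\<And>k. sym_pos_def (B k)"
    and H_inv: "\<And>k. H k = matrix_inv (B k)"
    and \<xi>_subgrad: "\<And>k. \<xi> k \<in> subdifferential (\<lambda>u. ereal (h2 u)) (x k)"
    and \<theta>_range: "\<And>k. \<theta>bar \<le> \<theta> k \<and> \<theta> k \<le> 1"
    and r_incl: "\<And>k. r k \<in> (grad_g (x k) - \<xi> k + B k *v (xp k - x k)) +o subdifferential h1 (xp k)"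
    and r_bound: "\<And>k. weighted_norm (H k) (r k) \<le> (1 - \<theta> k) * weighted_norm (B k) (xp k - x k)"
    and d_eq: "\<And>k. d k = xp k - x k"
    and line_search: "\<And>k. backtracking_result \<beta>min \<beta>max
          (\<lambda>\<rho>. f (x k + \<rho> *\<^sub>R d k) \<le> f (x k)
             + ereal (\<delta> * \<rho>) * (ereal ((grad_g (x k) - \<xi> k) \<bullet> d k) + h1 (xp k) - h1 (x k)))
          (\<eta> k)"
    and x_step: "\<And>k. x (Suc k) = x k + \<eta> k *\<^sub>R d k"
    and mM_pos: "m > 0" "M > 0"
    and B_bounds: "\<And>k u. m * (norm u)\<^sup>2 \<le> u \<bullet> (B k *v u) \<and> u \<bullet> (B k *v u) \<le> M * (norm u)\<^sup>2"
    and d_nonzero: "\<And>k. d k \<noteq> 0"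
    and f_bounded_below: "\<exists>c::real. \<forall>u. ereal c \<le> f u"
  shows "(\<lambda>k. norm (d k)) \<longlonglongrightarrow> 0 \<and>
    (bounded (range x) \<longrightarrow>
      (\<forall>xstar. (\<exists>\<sigma>::nat \<Rightarrow> nat. strict_mono \<sigma> \<and> (x \<circ> \<sigma>) \<longlonglongrightarrow> xstar) \<longrightarrow>
        critical_point grad_g h1 h2 xstar))"
proof -
  \<comment> \<open>The subgradient of \<open>h1\<close> at \<open>xp k\<close> that the residual
    inclusion contains.\<close>
  define s where "s k = r k - (grad_g (x k) - \<xi> k + B k *v d k)" for k
  have s: "s k \<in> subdifferential h1 (xp k)" for k
    using r_incl[of k] by (auto simp: s_def d_eq elt_set_plus_def algebra_simps)
  have h1_fin: "\<bar>h1 u\<bar> \<noteq> \<infinity>" if "f u < \<infinity>" for u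
    using that h1_proper unfolding f_eq proper_fun_def by (cases "h1 u") auto
  \<comment> \<open>\<open>real_of_ereal\<close> maps infinite values to \<open>0\<close>, so
    \<open>\<phi>\<close> represents \<open>h1\<close> only where \<open>h1\<close> is
    finite.\<close>
  define \<phi> where "\<phi> = real_of_ereal \<circ> h1"
  have \<phi>: "h1 u = ereal (\<phi> u)" if "\<bar>h1 u\<bar> \<noteq> \<infinity>" for u
    using that by (simp add: \<phi>_def ereal_real')
  have h1_xp: "h1 (xp k) = ereal (\<phi> (xp k))" for k
    using s[of k] by (intro \<phi>) (simp add: subdifferential_def)
  define \<Delta> where "\<Delta> k = (grad_g (x k) - \<xi> k) \<bullet> d k + \<phi> (xp k) - \<phi> (x k)" for k
  define ok where "ok k = (\<lambda>\<rho>. f (x k + \<rho> *\<^sub>R d k) \<le> f (x k)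
             + ereal (\<delta> * \<rho>) * (ereal ((grad_g (x k) - \<xi> k) \<bullet> d k) + h1 (xp k) - h1 (x k)))" for k
  have ok_iff: "ok k \<rho> \<longleftrightarrow> f (x k + \<rho> *\<^sub>R d k) \<le> ereal (g (x k) + \<phi> (x k) - h2 (x k) + \<delta> * \<rho> * \<Delta> k)"
    if "h1 (x k) = ereal (\<phi> (x k))" for k \<rho>
    unfolding ok_def by (simp add: f_eq[of "x k"] that h1_xp \<Delta>_def)
  \<comment> \<open>Chosen so that for \<open>\<rho> \<le> \<rho>0\<close> the curvature term
    \<open>L * \<rho> * (norm (d k))\<^sup>2\<close> is at most
    \<open>(1 - \<delta>) * - \<Delta> k\<close>, the slack in the acceptance test.\<close>
  define \<rho>0 where "\<rho>0 = (1 - \<delta>) * \<theta>bar * m / L"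
  define \<eta>0 where "\<eta>0 = min 1 (\<beta>min * \<rho>0)"
  have \<eta>0: "\<eta>0 > 0" using \<delta> \<theta>bar mM_pos L_pos \<beta> by (simp add: \<eta>0_def \<rho>0_def)
  have wB_sq: "(weighted_norm (B k) u)\<^sup>2 = u \<bullet> (B k *v u)" for k u
    using sym_pos_def_nonneg[OF B_spd] by (simp add: weighted_norm_def)

  \<comment> \<open>Model decrease and acceptance of small steps\<close>
  have \<Delta>_le: "\<Delta> k \<le> - (\<theta>bar * m * (norm (d k))\<^sup>2)" if fin: "h1 (x k) = ereal (\<phi> (x k))" for k
  proof -
    have "h1 (xp k) + ereal (s k \<bullet> (x k - xp k)) \<le> h1 (x k)"
      using s[of k] by (simp add: subdifferential_def)
    then have "\<phi> (xp k) + s k \<bullet> (x k - xp k) \<le> \<phi> (x k)"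
      by (simp add: h1_xp fin)
    then have "\<phi> (xp k) - \<phi> (x k) \<le> s k \<bullet> d k"
      by (simp add: d_eq inner_diff_right)
    \<comment> \<open>Inserting \<open>s k\<close> cancels the gradient and \<open>\<xi> k\<close>.
      The residual then costs at most the fraction \<open>1 - \<theta> k\<close> of the quadratic
      term.\<close>
    then have "\<Delta> k \<le> r k \<bullet> d k - d k \<bullet> (B k *v d k)"
      unfolding \<Delta>_def s_def
      by (simp add: inner_diff_left inner_add_left inner_commute[of "B k *v d k"])
    also have "r k \<bullet> d k \<le> weighted_norm (H k) (r k) * weighted_norm (B k) (d k)"
      unfolding H_inv by (rule inner_le_dual_weighted_norm[OF B_spd])
    also have "\<dots> \<le> (1 - \<theta> k) * weighted_norm (B k) (d k) * weighted_norm (B k) (d k)"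
      using r_bound[of k] by (intro mult_right_mono weighted_norm_nonneg B_spd) (simp add: d_eq)
    also have "\<dots> = (1 - \<theta> k) * (d k \<bullet> (B k *v d k))"
      using wB_sq[of k "d k"] by (simp add: power2_eq_square)
    finally have "\<Delta> k \<le> - (\<theta> k * (d k \<bullet> (B k *v d k)))"
      by (simp add: algebra_simps)
    moreover have "\<theta>bar * (m * (norm (d k))\<^sup>2) \<le> \<theta> k * (d k \<bullet> (B k *v d k))"
      using \<theta>_range[of k] B_bounds[of "d k" k] mM_pos \<theta>bar by (intro mult_mono) auto
    ultimately show ?thesis by simp
  qed

  have model: "f (x k + \<rho> *\<^sub>R d k)
      \<le> ereal (g (x k) + \<phi> (x k) - h2 (x k) + \<rho> * \<Delta> k + L * \<rho>\<^sup>2 * (norm (d k))\<^sup>2)"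
    if fin: "h1 (x k) = ereal (\<phi> (x k))" and \<rho>: "0 < \<rho>" "\<rho> \<le> 1" for k \<rho>
  proof -
    let ?y = "x k + \<rho> *\<^sub>R d k"
    have "?y = (1 - \<rho>) *\<^sub>R x k + \<rho> *\<^sub>R xp k"
      by (simp add: d_eq algebra_simps)
    then have "h1 ?y \<le> ereal (1 - \<rho>) * h1 (x k) + ereal \<rho> * h1 (xp k)"
      using h1_convex \<rho> unfolding convex_fun_def by simp
    then have h1_le: "h1 ?y \<le> ereal ((1 - \<rho>) * \<phi> (x k) + \<rho> * \<phi> (xp k))"
      by (simp add: fin h1_xp)
    then have "h1 ?y = ereal (\<phi> ?y)"
      using h1_proper by (intro \<phi>) (auto simp: proper_fun_def)
    moreover from this h1_le have "\<phi> ?y \<le> (1 - \<rho>) * \<phi> (x k) + \<rho> * \<phi> (xp k)" by simp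
    moreover have "g ?y \<le> g (x k) + \<rho> * (grad_g (x k) \<bullet> d k) + L * \<rho>\<^sup>2 * (norm (d k))\<^sup>2"
      by (rule lipschitz_gradient_upper_bound[OF g_grad grad_lipschitz L_pos \<rho>(1)])
    \<comment> \<open>The concave part \<open>- h2\<close> lies below its linearisation, so it adds
      no curvature term.\<close>
    moreover have "h2 (x k) + \<rho> * (\<xi> k \<bullet> d k) \<le> h2 ?y"
      using subdifferential_realD[OF \<xi>_subgrad[of k], of ?y] by simp
    ultimately show ?thesis
      by (simp add: f_eq \<Delta>_def algebra_simps)
  qed

  have accept: "ok k \<rho>"
    if fin: "h1 (x k) = ereal (\<phi> (x k))" and \<rho>: "0 < \<rho>" "\<rho> \<le> 1" "\<rho> \<le> \<rho>0" for k \<rho>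
  proof -
    have "L * \<rho> \<le> (1 - \<delta>) * \<theta>bar * m"
      using \<rho> L_pos by (simp add: \<rho>0_def field_simps)
    then have "L * \<rho> * (norm (d k))\<^sup>2 \<le> (1 - \<delta>) * \<theta>bar * m * (norm (d k))\<^sup>2"
      by (intro mult_right_mono) auto
    also have "\<dots> = (1 - \<delta>) * (\<theta>bar * m * (norm (d k))\<^sup>2)" by simp
    also have "\<dots> \<le> (1 - \<delta>) * - \<Delta> k"
      using \<Delta>_le[OF fin] \<delta> by (intro mult_left_mono) auto
    finally have "\<rho> * (L * \<rho> * (norm (d k))\<^sup>2) \<le> \<rho> * ((1 - \<delta>) * - \<Delta> k)"
      using \<rho> by (intro mult_left_mono) auto
    then have "\<rho> * \<Delta> k + L * \<rho>\<^sup>2 * (norm (d k))\<^sup>2 \<le> \<delta> * \<rho> * \<Delta> k"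
      by (simp add: algebra_simps power2_eq_square)
    then show ?thesis
      unfolding ok_iff[OF fin] by (intro order_trans[OF model[OF fin \<rho>(1,2)]]) simp
  qed

  have step: "\<eta>0 \<le> \<eta> k \<and> f (x (Suc k)) \<le> ereal (g (x k) + \<phi> (x k) - h2 (x k) + \<delta> * \<eta> k * \<Delta> k)"
    if fin: "h1 (x k) = ereal (\<phi> (x k))" for k
  proof -
    have "backtracking_trial \<beta>min \<beta>max (ok k) (\<eta> k)" "ok k (\<eta> k)"
      using line_search[of k] unfolding backtracking_result_def ok_def by auto
    moreover from this(1) have "\<eta>0 \<le> \<eta> k"
      unfolding \<eta>0_def
      using backtracking_trial_lower_bound[OF _ \<beta>(1,3), where ok = "ok k" and \<rho> = "\<eta> k" and ?\<rho>0.0 = \<rho>0] accept[OF fin] by blast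
    ultimately show ?thesis
      using ok_iff[OF fin] by (simp add: x_step)
  qed

  \<comment> \<open>An accepted step puts \<open>f\<close> below a real number, so finiteness of
    \<open>h1\<close> passes to the next iterate; this discharges the condition on the claims
    above.\<close>
  have fin: "h1 (x k) = ereal (\<phi> (x k))" for k
  proof (induction k)
    case 0
    then show ?case using x0 by (intro \<phi> h1_fin) (simp add: eff_domain_def)
  next
    case (Suc k)
    then have "f (x (Suc k)) < \<infinity>"
      using step[of k] by (meson ereal_infty_less(1) le_less_trans less_ereal.simps(4) ereal_less(4))
    then show ?case by (intro \<phi> h1_fin)
  qed

  \<comment> \<open>Convergence of the directions to zero\<close>
  obtain c where c: "\<And>u. ereal c \<le> f u" using f_bounded_below by blast
  have d_lim: "(\<lambda>k. norm (d k)) \<longlonglongrightarrow> 0"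
  proof (rule tendsto_zero_if_square_decrease)
    \<comment> \<open>The decreasing sequence is the real value of \<open>f (x k)\<close>.\<close>
    show "c \<le> g (x k) + \<phi> (x k) - h2 (x k)" for k
      using c[of "x k"] by (simp add: f_eq fin)
    show "\<delta> * \<eta>0 * (\<theta>bar * m) > 0" using \<delta> \<eta>0 \<theta>bar mM_pos by simp
    fix k
    have "\<eta>0 * (\<theta>bar * m * (norm (d k))\<^sup>2) \<le> \<eta> k * - \<Delta> k"
      using step[OF fin, of k] \<Delta>_le[OF fin, of k] \<eta>0 \<theta>bar mM_pos by (intro mult_mono) auto
    then have "\<delta> * (\<eta>0 * (\<theta>bar * m * (norm (d k))\<^sup>2)) \<le> \<delta> * (\<eta> k * - \<Delta> k)"
      using \<delta> by (intro mult_left_mono) auto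
    moreover have "g (x (Suc k)) + \<phi> (x (Suc k)) - h2 (x (Suc k))
        \<le> g (x k) + \<phi> (x k) - h2 (x k) + \<delta> * \<eta> k * \<Delta> k"
      using step[OF fin, of k] by (simp add: f_eq fin)
    ultimately show "g (x (Suc k)) + \<phi> (x (Suc k)) - h2 (x (Suc k))
        \<le> g (x k) + \<phi> (x k) - h2 (x k) - \<delta> * \<eta>0 * (\<theta>bar * m) * (norm (d k))\<^sup>2"
      by (simp add: algebra_simps)
  qed

  \<comment> \<open>Criticality of accumulation points\<close>
  have Bd_lim: "(\<lambda>k. B k *v d k) \<longlonglongrightarrow> 0"
  proof (rule Lim_null_comparison)
    show "eventually (\<lambda>k. norm (B k *v d k) \<le> M * norm (d k)) sequentially"
      using norm_matrix_vector_le[OF B_spd mM_pos(2)] B_bounds by simp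
    show "(\<lambda>k. M * norm (d k)) \<longlonglongrightarrow> 0"
      using tendsto_mult_right_zero[OF d_lim] .
  qed
  have r_lim: "r \<longlonglongrightarrow> 0"
  proof (rule Lim_null_comparison)
    have "weighted_norm (H k) (r k) \<le> weighted_norm (B k) (d k)" for k
    proof -
      have "(1 - \<theta> k) * weighted_norm (B k) (d k) \<le> 1 * weighted_norm (B k) (d k)"
        using \<theta>_range[of k] \<theta>bar by (intro mult_right_mono weighted_norm_nonneg B_spd) auto
      with r_bound[of k] show ?thesis by (simp add: d_eq)
    qed
    then show "eventually (\<lambda>k. norm (r k) \<le> M * norm (d k)) sequentially"
      using norm_residual_le[OF B_spd mM_pos(2)] B_bounds unfolding H_inv
      by (intro always_eventually) blast
    show "(\<lambda>k. M * norm (d k)) \<longlonglongrightarrow> 0"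
      using tendsto_mult_right_zero[OF d_lim] .
  qed

  have "critical_point grad_g h1 h2 a" if \<sigma>: "strict_mono \<sigma>" and lim: "(x \<circ> \<sigma>) \<longlonglongrightarrow> a" for \<sigma> a
  proof -
    \<comment> \<open>The convergent sequence \<open>x \<circ> \<sigma>\<close> is bounded, hence so
      are its subgradients, and a further subsequence \<open>\<mu>\<close> makes them converge
      too.\<close>
    have "bounded (range (\<xi> \<circ> \<sigma>))"
      by (rule subgradients_bounded[OF h2_cont convergent_imp_bounded[OF lim]])
        (use \<xi>_subgrad in simp)
    then obtain z \<tau> where \<tau>: "strict_mono \<tau>" and \<xi>_lim: "(\<xi> \<circ> \<sigma> \<circ> \<tau>) \<longlonglongrightarrow> z"
      using bounded_imp_convergent_subsequence by blast
    define \<mu> where "\<mu> = \<sigma> \<circ> \<tau>"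
    have \<mu>: "strict_mono \<mu>" unfolding \<mu>_def by (rule strict_mono_o[OF \<sigma> \<tau>])
    have \<xi>_lim: "(\<lambda>k. \<xi> (\<mu> k)) \<longlonglongrightarrow> z"
      using \<xi>_lim by (simp add: \<mu>_def o_def)
    have x_lim: "(\<lambda>k. x (\<mu> k)) \<longlonglongrightarrow> a"
      using LIMSEQ_subseq_LIMSEQ[OF lim \<tau>] by (simp add: \<mu>_def o_def)
    have sub0: "(\<lambda>k. w (\<mu> k)) \<longlonglongrightarrow> 0" if "w \<longlonglongrightarrow> 0" for w :: "nat \<Rightarrow> real^'n"
      using LIMSEQ_subseq_LIMSEQ[OF that \<mu>] by (simp add: o_def)
    have "(\<lambda>k. x (\<mu> k) + d (\<mu> k)) \<longlonglongrightarrow> a + 0"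
      by (intro tendsto_add x_lim sub0) (use d_lim tendsto_norm_zero_iff in blast)
    then have xp_lim: "(\<lambda>k. xp (\<mu> k)) \<longlonglongrightarrow> a" by (simp add: d_eq)
    have "(\<lambda>k. grad_g (x (\<mu> k))) \<longlonglongrightarrow> grad_g a"
      using grad_cont by (intro continuous_on_tendsto_compose[OF _ x_lim]) auto
    \<comment> \<open>The two zeros are the limits of \<open>r\<close> and of
      \<open>B k *v d k\<close>.\<close>
    then have "(\<lambda>k. s (\<mu> k)) \<longlonglongrightarrow> 0 - (grad_g a - z + 0)"
      unfolding s_def by (intro tendsto_intros sub0 r_lim Bd_lim \<xi>_lim)
    then have "(\<lambda>k. s (\<mu> k)) \<longlonglongrightarrow> z - grad_g a" by simp
    then have "z - grad_g a \<in> subdifferential h1 a"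
      by (rule subdifferential_closed_graph[OF h1_proper h1_lsc s xp_lim])
    \<comment> \<open>The same \<open>z\<close> lies in both sets of the Minkowski difference, so
      \<open>z - z = 0\<close> witnesses criticality.\<close>
    then have "z \<in> grad_g a +o subdifferential h1 a"
      unfolding elt_set_plus_def by force
    moreover have "z \<in> subdifferential (\<lambda>u. ereal (h2 u)) a"
      by (rule subdifferential_closed_graph[OF _ lsc_fun_ereal_continuous[OF h2_cont] \<xi>_subgrad
            x_lim \<xi>_lim]) (simp add: proper_fun_def eff_domain_def)
    ultimately show ?thesis
      unfolding critical_point_def minkowski_diff_def by force
  qed
  with d_lim show ?thesis by blast
qed

end
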